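(* Let $m\in\mathbb{N}_0$ be even and let $k>0$ be real. Then the function $$U(x)=\frac{\beta^{(m)}(kx)}{\left[\beta^{(m)}(x)\right]^k},\qquad x>0,$$ is increasing if $k>1$ and decreasing if $0<k\le 1$.
   Context: Nielsen's $\beta$-function is the function $\beta:(0,\infty)\to\mathbb{R}$ defined by $\beta(x)=\int_0^1 \frac{t^{x-1}}{1+t}\,dt=\int_0^\infty\frac{e^{-xt}}{1+e^{-t}}\,dt$ for $x>0$. For $m\in\mathbb{N}_0=\{0,1,2,\dots\}$, $\beta^{(m)}$ denotes its $m$-th derivative, with $\beta^{(0)}=\beta$. "Increasing" and "decreasing" are understood in the weak (non-strict) sense (for $k=1$ the function $U$ is constant). *)

theory Defs
  imports "HOL-Analysis.Analysis"
begin

(* Lebesgue integral over the open interval (0,1); the integrand is integrable there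
   exactly for x > 0, so values at x \<le> 0 carry no meaning. *)
definition nielsen_beta :: "real \<Rightarrow> real" where
  "nielsen_beta x = (LBINT t=0..1. t powr (x - 1) / (1 + t))"

(* Since (0,\<infinity>) is open, deriv at x > 0 depends only on values at positive arguments. *)
definition nielsen_beta_deriv :: "nat \<Rightarrow> real \<Rightarrow> real" where
  "nielsen_beta_deriv m = (deriv ^^ m) nielsen_beta"

end

theory Submission
  imports Defs
begin

text \<open>
  For even \<open>m\<close> the function \<open>f = \<beta>\<^sup>(\<^sup>m\<^sup>)\<close> is positive and log-convex, that is, \<open>f' / f\<close> is increasing,
  and this decides the sign of
  \[ (\ln U)'(x) = k \left( \frac{f'(kx)}{f(kx)} - \frac{f'(x)}{f(x)} \right), \]
  because \<open>k x\<close> lies to the right of \<open>x\<close> for \<open>k > 1\<close> and not to the right of it for \<open>k \<le> 1\<close>.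

  Differentiating under the integral sign gives
  \[ \beta^{(n)}(x) = \int_0^1 \frac{(\ln t)^n \, t^{x-1}}{1+t} \, dt \]
  for every \<open>n\<close> (\<open>log_moment_has_derivative\<close>, \<open>nielsen_beta_deriv_eq_log_moment\<close>). Thus the
  derivatives of \<open>\<beta>\<close> at \<open>x\<close> are the moments of \<open>ln t\<close> under one positive weight. Moments of even
  order are positive, and three consecutive moments starting at an even order satisfy a
  Cauchy--Schwarz inequality (\<open>log_moment_Suc_squared_le\<close>), which says precisely that the derivative
  of \<open>f' / f\<close> is nonnegative.
\<close>

section \<open>Logarithmic moments and the derivatives of the beta function\<close>

definition log_moment :: "nat \<Rightarrow> real \<Rightarrow> real" where
  "log_moment n x = (LINT t:{0<..<1}|lborel. ln t ^ n * t powr (x - 1) / (1 + t))"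

lemma nielsen_beta_eq_log_moment: "nielsen_beta x = log_moment 0 x"
  by (simp add: nielsen_beta_def log_moment_def interval_lebesgue_integral_def
      zero_ereal_def one_ereal_def)

text \<open>
  Every power of the logarithm is dominated near \<open>0\<close> by an arbitrarily small negative power of \<open>t\<close>:
  with \<open>u = b \<bar>ln t\<bar>\<close>, the single term \<open>u\<^sup>n / n!\<close> of the exponential series is at most
  \<open>exp u = t\<^sup>-\<^sup>b\<close>.
\<close>
lemma abs_ln_power_le_powr:
  fixes t b :: real
  assumes t: "0 < t" "t < 1" and b: "b > 0"
  shows "\<bar>ln t\<bar> ^ n \<le> fact n / b ^ n * t powr (-b)"
proof -
  define u where "u = b * \<bar>ln t\<bar>"
  have u: "u \<ge> 0" using b by (simp add: u_def)
  obtain s where s: "exp u = (\<Sum>m<Suc n. u ^ m / fact m) + exp s / fact (Suc n) * u ^ Suc n"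
    using Maclaurin_exp_le[of u "Suc n"] by blast
  have "u ^ n / fact n \<le> exp u"
    unfolding s by (auto intro!: add_increasing2 add_increasing sum_nonneg simp: u)
  also have "exp u = t powr (-b)"
    using t by (simp add: u_def powr_def)
  finally have "b ^ n * \<bar>ln t\<bar> ^ n \<le> fact n * t powr (-b)"
    by (simp add: u_def power_mult_distrib field_simps)
  then show ?thesis using b by (simp add: field_simps)
qed

text \<open>
  Half of the exponent \<open>x\<close> is spent on absorbing the logarithms; the other half keeps the dominating
  power \<open>t powr (x/2 - 1)\<close> integrable at \<open>0\<close>.
\<close>
lemma set_integrable_log_moment:
  fixes x :: real
  assumes x: "x > 0"
  shows "set_integrable lborel {0<..<1} (\<lambda>t. ln t ^ n * t powr (x - 1) / (1 + t))"
proof (rule set_integrable_bound)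
  have "(\<lambda>t::real. t powr (x/2 - 1)) absolutely_integrable_on {0<..1::real}"
    using x by (intro nonnegative_absolutely_integrable_1 integrable_on_powr_from_0') auto
  then have "set_integrable lborel {0<..1} (\<lambda>t::real. t powr (x/2 - 1))"
    unfolding set_integrable_def by (subst (asm) integrable_completion) auto
  then have "set_integrable lborel {0<..<1} (\<lambda>t::real. t powr (x/2 - 1))"
    by (rule set_integrable_subset) auto
  then show "set_integrable lborel {0<..<1} (\<lambda>t::real. fact n / (x/2) ^ n * t powr (x/2 - 1))"
    by simp
  show "set_borel_measurable lborel {0<..<1} (\<lambda>t. ln t ^ n * t powr (x - 1) / (1 + t))"
    unfolding set_borel_measurable_def by measurable
  show "AE t in lborel. t \<in> {0<..<1} \<longrightarrow> norm (ln t ^ n * t powr (x - 1) / (1 + t))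
          \<le> norm (fact n / (x/2) ^ n * t powr (x/2 - 1))"
  proof (intro AE_I2 impI)
    fix t :: real assume t: "t \<in> {0<..<1}"
    have "norm (ln t ^ n * t powr (x - 1) / (1 + t)) \<le> \<bar>ln t\<bar> ^ n * t powr (x - 1)"
      using t mult_right_mono[of 1 "1 + t" "\<bar>ln t ^ n * t powr (x - 1)\<bar>"]
      by (simp add: abs_mult power_abs divide_le_eq mult.commute)
    also have "\<dots> \<le> fact n / (x/2) ^ n * t powr (-(x/2)) * t powr (x - 1)"
      using abs_ln_power_le_powr[of t "x/2" n] t x by (intro mult_right_mono) auto
    also have "\<dots> = fact n / (x/2) ^ n * t powr (x/2 - 1)"
      by (simp add: powr_add[symmetric])
    finally show "norm (ln t ^ n * t powr (x - 1) / (1 + t))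
                    \<le> norm (fact n / (x/2) ^ n * t powr (x/2 - 1))"
      using x by simp
  qed
qed

text \<open>
  The first-order Taylor polynomial of \<open>y \<mapsto> t powr (y - 1)\<close> at \<open>x\<close> leaves a Lagrange remainder; the
  point is to bound it by \<open>(y - x)\<^sup>2\<close> times a function of \<open>t\<close> that does not depend on \<open>y\<close>. Integrated
  over \<open>t\<close>, this controls the error in differentiating under the integral sign. Since \<open>ln t < 0\<close>,
  the intermediate exponential costs at most the factor \<open>t powr (-d)\<close>.
\<close>
lemma powr_taylor_remainder:
  fixes t x y :: real
  assumes t: "0 < t" "t < 1" and h: "\<bar>y - x\<bar> \<le> d"
  shows "\<bar>t powr (y - 1) - t powr (x - 1) - (y - x) * (ln t * t powr (x - 1))\<bar>
           \<le> (y - x)\<^sup>2 * ((ln t)\<^sup>2 * t powr (x - d - 1))"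
proof -
  define u where "u = (y - x) * ln t"
  obtain s where s: "\<bar>s\<bar> \<le> \<bar>u\<bar>" "exp u = (\<Sum>m<2. u ^ m / fact m) + exp s / fact 2 * u ^ 2"
    using Maclaurin_exp_le[of u 2] by blast
  have "\<bar>u\<bar> \<le> d * \<bar>ln t\<bar>"
    unfolding u_def abs_mult by (intro mult_right_mono h) auto
  then have "s \<le> - d * ln t" using s(1) t by simp
  then have es: "exp s \<le> t powr (-d)" using t by (simp add: powr_def)
  have "t powr (y - 1) = t powr (x - 1) * exp u"
    using t by (simp add: u_def powr_def exp_add[symmetric] algebra_simps)
  then have "t powr (y - 1) - t powr (x - 1) - (y - x) * (ln t * t powr (x - 1))
      = t powr (x - 1) * (exp u - 1 - u)"
    by (simp add: u_def algebra_simps)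
  also have "exp u - 1 - u = exp s / 2 * u\<^sup>2"
    using s(2) by (simp add: numeral_2_eq_2)
  finally have "\<bar>t powr (y - 1) - t powr (x - 1) - (y - x) * (ln t * t powr (x - 1))\<bar>
      = \<bar>t powr (x - 1) * (exp s / 2 * u\<^sup>2)\<bar>"
    by (simp only:)
  also have "\<dots> = t powr (x - 1) * (exp s / 2 * u\<^sup>2)"
    by simp
  also have "\<dots> \<le> t powr (x - 1) * (t powr (-d) * u\<^sup>2)"
    using es order_trans[OF _ es, of "exp s / 2"] by (intro mult_left_mono mult_right_mono) auto
  also have "\<dots> = (y - x)\<^sup>2 * ((ln t)\<^sup>2 * (t powr (x - 1) * t powr (-d)))"
    by (simp add: u_def power_mult_distrib)
  also have "t powr (x - 1) * t powr (-d) = t powr (x - d - 1)"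
    by (simp add: powr_add[symmetric] algebra_simps)
  finally show ?thesis .
qed

text \<open>
  For \<open>\<bar>y - x\<bar> \<le> x/2\<close> the Taylor remainder, weighted with \<open>(ln t)\<^sup>n / (1 + t)\<close>, is at most
  \<open>(y - x)\<^sup>2\<close> times the absolute value of the integrand of the moment of order \<open>n + 2\<close> at \<open>x/2\<close>,
  which is still integrable. So the difference quotient deviates from the moment of order \<open>n + 1\<close>
  by \<open>O(\<bar>y - x\<bar>)\<close>.
\<close>
lemma log_moment_has_derivative:
  assumes x: "x > 0"
  shows "(log_moment n has_real_derivative log_moment (Suc n) x) (at x)"
proof -
  let ?f = "\<lambda>n x t. ln t ^ n * t powr (x - 1) / (1 + t) :: real"
  define C where "C = (LINT t:{0<..<1}|lborel. \<bar>?f (n + 2) (x/2) t\<bar>)"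
  note int = set_integrable_log_moment
  have bound: "\<bar>log_moment n y - log_moment n x - (y - x) * log_moment (Suc n) x\<bar> \<le> (y - x)\<^sup>2 * C"
    if h: "\<bar>y - x\<bar> \<le> x/2" for y
  proof -
    have y: "y > 0" using h x by linarith
    let ?D = "\<lambda>t. ?f n y t - ?f n x t - (y - x) * ?f (Suc n) x t"
    have i1: "set_integrable lborel {0<..<1} (\<lambda>t. ?f n y t - ?f n x t)"
      by (rule set_integral_diff(1)[OF int[OF y] int[OF x]])
    have i2: "set_integrable lborel {0<..<1} (\<lambda>t. (y - x) * ?f (Suc n) x t)"
      by (rule set_integrable_mult_right) (rule int[OF x])
    note iD = set_integral_diff(1)[OF i1 i2]
    have eq: "log_moment n y - log_moment n x - (y - x) * log_moment (Suc n) x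
            = (LINT t:{0<..<1}|lborel. ?D t)"
      by (simp only: set_integral_diff(2)[OF i1 i2] set_integral_diff(2)[OF int[OF y] int[OF x]]
          set_integral_mult_right log_moment_def)
    have "\<bar>log_moment n y - log_moment n x - (y - x) * log_moment (Suc n) x\<bar>
            \<le> (LINT t:{0<..<1}|lborel. \<bar>?D t\<bar>)"
      unfolding eq using set_integral_norm_bound[OF iD] by simp
    also have "\<dots> \<le> (LINT t:{0<..<1}|lborel. (y - x)\<^sup>2 * \<bar>?f (n + 2) (x/2) t\<bar>)"
    proof (rule set_integral_mono)
      show "set_integrable lborel {0<..<1} (\<lambda>t. \<bar>?D t\<bar>)"
        by (rule set_integrable_abs[OF iD])
      have "set_integrable lborel {0<..<1} (?f (n + 2) (x/2))"
        using x by (intro int) simp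
      then show "set_integrable lborel {0<..<1} (\<lambda>t. (y - x)\<^sup>2 * \<bar>?f (n + 2) (x/2) t\<bar>)"
        by (intro set_integrable_mult_right set_integrable_abs)
      fix t :: real assume t: "t \<in> {0<..<1}"
      let ?r = "t powr (y - 1) - t powr (x - 1) - (y - x) * (ln t * t powr (x - 1))"
      have "?D t = ln t ^ n / (1 + t) * ?r"
        by (simp add: diff_divide_distrib right_diff_distrib mult_ac)
      then have "\<bar>?D t\<bar> = \<bar>ln t ^ n / (1 + t)\<bar> * \<bar>?r\<bar>"
        by (simp only: abs_mult)
      also have "\<dots> \<le> \<bar>ln t ^ n / (1 + t)\<bar> * ((y - x)\<^sup>2 * ((ln t)\<^sup>2 * t powr (x - x/2 - 1)))"
        using t h by (intro mult_left_mono powr_taylor_remainder) auto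
      also have "\<dots> = (y - x)\<^sup>2 * \<bar>?f (n + 2) (x/2) t\<bar>"
        by (simp add: abs_mult power_add power2_eq_square)
      finally show "\<bar>?D t\<bar> \<le> (y - x)\<^sup>2 * \<bar>?f (n + 2) (x/2) t\<bar>" .
    qed
    also have "\<dots> = (y - x)\<^sup>2 * C"
      by (simp only: set_integral_mult_right C_def)
    finally show ?thesis .
  qed
  have "((\<lambda>y. (log_moment n y - log_moment n x) / (y - x) - log_moment (Suc n) x) \<longlongrightarrow> 0) (at x)"
  proof (rule Lim_null_comparison)
    have "\<forall>\<^sub>F y in at x. dist y x < x/2 \<and> y \<noteq> x"
      using x by (auto simp: eventually_at intro!: exI[of _ "x/2"])
    then show "\<forall>\<^sub>F y in at x. norm ((log_moment n y - log_moment n x) / (y - x)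
                 - log_moment (Suc n) x) \<le> \<bar>y - x\<bar> * C"
    proof eventually_elim
      case (elim y)
      have "(log_moment n y - log_moment n x) / (y - x) - log_moment (Suc n) x
          = (log_moment n y - log_moment n x - (y - x) * log_moment (Suc n) x) / (y - x)"
        using elim by (simp add: diff_divide_distrib)
      then have "norm ((log_moment n y - log_moment n x) / (y - x) - log_moment (Suc n) x)
          = \<bar>log_moment n y - log_moment n x - (y - x) * log_moment (Suc n) x\<bar> / \<bar>y - x\<bar>"
        by simp
      also have "\<dots> \<le> (y - x)\<^sup>2 * C / \<bar>y - x\<bar>"
        using elim by (intro divide_right_mono bound) (auto simp: dist_real_def)
      also have "\<dots> = \<bar>y - x\<bar> * C"
      proof -
        have "\<bar>y - x\<bar> \<noteq> 0" using elim by simp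
        then have "\<bar>y - x\<bar> * (\<bar>y - x\<bar> * C) / \<bar>y - x\<bar> = \<bar>y - x\<bar> * C"
          by (rule nonzero_mult_div_cancel_left)
        moreover have "(y - x)\<^sup>2 * C = \<bar>y - x\<bar> * (\<bar>y - x\<bar> * C)"
          by (simp add: power2_eq_square mult.assoc[symmetric])
        ultimately show ?thesis by (simp only:)
      qed
      finally show ?case .
    qed
    have "((\<lambda>y. \<bar>y - x\<bar> * C) \<longlongrightarrow> \<bar>x - x\<bar> * C) (at x)"
      by (intro tendsto_intros)
    then show "((\<lambda>y. \<bar>y - x\<bar> * C) \<longlongrightarrow> 0) (at x)" by simp
  qed
  then show ?thesis
    unfolding has_field_derivative_iff by (rule LIM_zero_cancel)
qed

lemma nielsen_beta_deriv_eq_log_moment: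
  "x > 0 \<Longrightarrow> nielsen_beta_deriv m x = log_moment m x"
proof (induction m arbitrary: x)
  case 0
  then show ?case by (simp add: nielsen_beta_deriv_def nielsen_beta_eq_log_moment)
next
  case (Suc m)
  have "\<forall>\<^sub>F y in nhds x. y > 0"
    using eventually_nhds_in_open[of "{0<..}" x] Suc.prems by simp
  then have ev: "\<forall>\<^sub>F y in nhds x. nielsen_beta_deriv m y = log_moment m y"
    by eventually_elim (rule Suc.IH)
  have "nielsen_beta_deriv (Suc m) x = deriv (nielsen_beta_deriv m) x"
    by (simp add: nielsen_beta_deriv_def)
  also have "\<dots> = deriv (log_moment m) x"
    by (rule deriv_cong_ev[OF ev refl])
  also have "\<dots> = log_moment (Suc m) x"
    by (rule DERIV_imp_deriv[OF log_moment_has_derivative[OF Suc.prems]])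
  finally show ?case .
qed

section \<open>Log-convexity of the even derivatives\<close>

lemma log_moment_pos:
  assumes n: "even n" and x: "x > 0"
  shows "log_moment n x > 0"
proof -
  let ?g = "\<lambda>t. indicator {0<..<1} t *\<^sub>R (ln t ^ n * t powr (x - 1) / (1 + t)) :: real"
  have nonneg: "AE t in lborel. 0 \<le> ?g t"
    using n by (intro AE_I2) (auto simp: indicator_def)
  have int: "integrable lborel ?g"
    using set_integrable_log_moment[OF x, of n] by (simp only: set_integrable_def)
  have "log_moment n x \<noteq> 0"
  proof
    assume "log_moment n x = 0"
    then have "AE t in lborel. ?g t = 0"
      using integral_nonneg_eq_0_iff_AE[OF int nonneg]
      by (simp only: log_moment_def set_lebesgue_integral_def)
    then have "AE t in lborel. t \<notin> {0<..<1::real}"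
      by eventually_elim (auto simp: indicator_def)
    then have "emeasure lborel {0<..<1::real} = 0"
      by (subst (asm) AE_iff_measurable[of "{0<..<1}"]) auto
    then show False by simp
  qed
  moreover have "log_moment n x \<ge> 0"
    unfolding log_moment_def set_lebesgue_integral_def by (rule integral_nonneg_AE[OF nonneg])
  ultimately show ?thesis by simp
qed

text \<open>
  Integrating \<open>(1 + c ln t)\<^sup>2 \<ge> 0\<close> against the nonnegative weight \<open>(ln t)\<^sup>n t\<^sup>x\<^sup>-\<^sup>1 / (1 + t)\<close> gives a
  quadratic polynomial in \<open>c\<close> that is nowhere negative; the inequality is the sign of its
  discriminant.
\<close>
lemma log_moment_Suc_squared_le:
  assumes n: "even n" and x: "x > 0"
  shows "(log_moment (Suc n) x)\<^sup>2 \<le> log_moment n x * log_moment (n + 2) x"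
proof -
  let ?f = "\<lambda>n t. ln t ^ n * t powr (x - 1) / (1 + t) :: real"
  let ?A = "log_moment n x" and ?B = "log_moment (Suc n) x" and ?C = "log_moment (n + 2) x"
  note int = set_integrable_log_moment[OF x]
  have C: "?C > 0" using n x by (intro log_moment_pos) auto
  \<comment> \<open>the minimiser of \<open>?A + 2 * c * ?B + c\<^sup>2 * ?C\<close>\<close>
  define c where "c = - ?B / ?C"
  have "0 \<le> (LINT t:{0<..<1}|lborel. ?f n t + (2 * c * ?f (Suc n) t + c\<^sup>2 * ?f (n + 2) t))"
    unfolding set_lebesgue_integral_def
  proof (intro integral_nonneg_AE AE_I2)
    fix t :: real
    have "?f n t + (2 * c * ?f (Suc n) t + c\<^sup>2 * ?f (n + 2) t) = (1 + c * ln t)\<^sup>2 * ?f n t"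
      by (simp add: power2_eq_square add_divide_distrib algebra_simps)
    then show "0 \<le> indicator {0<..<1} t *\<^sub>R (?f n t + (2 * c * ?f (Suc n) t + c\<^sup>2 * ?f (n + 2) t))"
      using n by (auto simp: indicator_def)
  qed
  also have "\<dots> = ?A + (2 * c * ?B + c\<^sup>2 * ?C)"
    unfolding log_moment_def set_integral_mult_right[symmetric]
    by (subst set_integral_add(2), (intro int set_integral_add(1) set_integrable_mult_right)+)
       (subst set_integral_add(2), (intro int set_integrable_mult_right refl)+)
  also have "\<dots> = ?A - ?B\<^sup>2 / ?C"
    using C by (simp add: c_def power2_eq_square field_simps)
  finally show ?thesis using C by (simp add: field_simps)
qed

lemma log_moment_ratio_mono:
  assumes n: "even n" and xy: "0 < x" "x \<le> y"
  shows "log_moment (Suc n) x / log_moment n x \<le> log_moment (Suc n) y / log_moment n y"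
proof (rule DERIV_nonneg_imp_nondecreasing[OF xy(2)])
  fix z assume "x \<le> z" "z \<le> y"
  then have z: "z > 0" using xy by simp
  have pos: "log_moment n z > 0" by (rule log_moment_pos[OF n z])
  have "((\<lambda>z. log_moment (Suc n) z / log_moment n z) has_real_derivative
          (log_moment (n + 2) z * log_moment n z - log_moment (Suc n) z * log_moment (Suc n) z)
            / (log_moment n z * log_moment n z)) (at z)"
    using DERIV_divide[OF log_moment_has_derivative[OF z] log_moment_has_derivative[OF z]] pos
    by simp
  moreover have "(log_moment (n + 2) z * log_moment n z
        - log_moment (Suc n) z * log_moment (Suc n) z) / (log_moment n z * log_moment n z) \<ge> 0"
    using log_moment_Suc_squared_le[OF n z] pos
    by (intro divide_nonneg_pos) (auto simp: power2_eq_square mult.commute)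
  ultimately show "\<exists>d. ((\<lambda>z. log_moment (Suc n) z / log_moment n z)
      has_real_derivative d) (at z) \<and> d \<ge> 0" by blast
qed

section \<open>Monotonicity of the quotient\<close>

theorem theorem2p13:
  fixes m :: nat and k :: real and U :: "real \<Rightarrow> real"
  assumes "even m" and "k > 0"
    and U_def: "\<And>x. x > 0 \<Longrightarrow> U x = nielsen_beta_deriv m (k * x) / (nielsen_beta_deriv m x) powr k"
  shows "(k > 1 \<longrightarrow> mono_on {0<..} U) \<and> (k \<le> 1 \<longrightarrow> antimono_on {0<..} U)"
proof -
  note k = \<open>k > 0\<close>
  let ?F = "log_moment m" and ?F' = "log_moment (Suc m)"
  define L where "L x = ln (?F (k * x)) - k * ln (?F x)" for x
  define L' where "L' x = k * (?F' (k * x) / ?F (k * x) - ?F' x / ?F x)" for x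
  have pos: "?F x > 0" if "x > 0" for x
    by (rule log_moment_pos[OF \<open>even m\<close> that])
  have U: "U x = exp (L x)" if x: "x > 0" for x
  proof -
    have "exp (ln (?F (k * x))) = ?F (k * x)"
      using x k pos[of "k * x"] by simp
    then show ?thesis
      using x k pos[OF x]
      by (simp add: U_def nielsen_beta_deriv_eq_log_moment L_def exp_diff powr_def)
  qed
  have dL: "(L has_real_derivative L' x) (at x)" if x: "x > 0" for x
  proof -
    have kx: "k * x > 0" using k x by simp
    have "((\<lambda>x. ?F (k * x)) has_real_derivative ?F' (k * x) * k) (at x)"
      by (rule DERIV_chain2[where g = "\<lambda>x. k * x" and x = x, OF log_moment_has_derivative[OF kx]])
         (auto intro!: derivative_eq_intros)
    from DERIV_chain2[where f = ln, OF DERIV_ln[OF pos[OF kx]] this]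
    have 1: "((\<lambda>x. ln (?F (k * x))) has_real_derivative
               inverse (?F (k * x)) * (?F' (k * x) * k)) (at x)" .
    from DERIV_chain2[where f = ln, OF DERIV_ln[OF pos[OF x]] log_moment_has_derivative[OF x]]
    have 2: "((\<lambda>x. k * ln (?F x)) has_real_derivative k * (inverse (?F x) * ?F' x)) (at x)"
      by (rule DERIV_cmult)
    have "L' x = inverse (?F (k * x)) * (?F' (k * x) * k) - k * (inverse (?F x) * ?F' x)"
      by (simp add: L'_def divide_inverse algebra_simps)
    with DERIV_diff[OF 1 2] show ?thesis
      unfolding L_def[abs_def] by simp
  qed
  have "mono_on {0<..} U" if "k > 1"
  proof (rule mono_onI)
    fix x y :: real assume xy: "x \<in> {0<..}" "y \<in> {0<..}" "x \<le> y"
    have "L x \<le> L y"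
    proof (rule DERIV_nonneg_imp_nondecreasing[OF xy(3)])
      fix z assume "x \<le> z" "z \<le> y"
      then have z: "z > 0" using xy by simp
      have "L' z \<ge> 0"
        using log_moment_ratio_mono[OF \<open>even m\<close> z, of "k * z"] that z by (simp add: L'_def)
      with dL[OF z] show "\<exists>d. (L has_real_derivative d) (at z) \<and> d \<ge> 0" by blast
    qed
    then show "U x \<le> U y" using xy by (simp add: U)
  qed
  moreover have "antimono_on {0<..} U" if "k \<le> 1"
  proof (rule monotone_onI)
    fix x y :: real assume xy: "x \<in> {0<..}" "y \<in> {0<..}" "x \<le> y"
    have "L y \<le> L x"
    proof (rule DERIV_nonpos_imp_nonincreasing[OF xy(3)])
      fix z assume "x \<le> z" "z \<le> y"
      then have z: "z > 0" using xy by simp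
      have "L' z \<le> 0"
        using log_moment_ratio_mono[OF \<open>even m\<close>, of "k * z" z] that z k
        by (simp add: L'_def mult_le_0_iff)
      with dL[OF z] show "\<exists>d. (L has_real_derivative d) (at z) \<and> d \<le> 0" by blast
    qed
    then show "U y \<le> U x" using xy by (simp add: U)
  qed
  ultimately show ?thesis by blast
qed

end
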